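(* Let $D^2=\{z=(z_1,z_2)\in\mathbf{C}^2:\ \operatorname{Im} z_2>\tfrac12|z_1|^2\}$. The set $\mathcal F$ of all $z=(z_1,z_2)\in D^2$ satisfying \begin{align*} & 0\le \operatorname{Re} z_1,\quad 0\le \operatorname{Im} z_1,\quad \operatorname{Re} z_1+\operatorname{Im} z_1\le 1,\quad |\operatorname{Re} z_2|\le \tfrac12,\\ & |z_2|^2\ge 1,\\ & |r+i-(1+i)z_1+z_2|^2\ge 1\quad\text{for } r=-1,0,1,\\ & |r+i-2iz_1+2z_2|^2\ge 2\quad\text{for } r=-1,1,\\ & |r+i-2z_1+2z_2|^2\ge 2\quad\text{for } r=-1,1, \end{align*} is a fundamental domain for the Picard modular group $\Gamma$ acting on $D^2$.
   Context: $D^2$ is the unbounded hyperquadric model of the complex hyperbolic space $\mathbf{CH}^2$. Picard modular group: $\Gamma=\{A\in SL(3,\mathbf C):\ A^*CA=C,\ a_{jk}\in\mathbf Z[i]\}$, where $C=\begin{pmatrix}0&0&i\\0&1&0\\-i&0&0\end{pmatrix}$ and $A^*$ is the conjugate transpose. A matrix $G=[g_{jk}]\in\Gamma$ acts on $D^2$ as the holomorphic automorphism $$G(z)=\left(\frac{g_{21}+g_{22}z_1+g_{23}z_2}{g_{11}+g_{12}z_1+g_{13}z_2},\ \frac{g_{31}+g_{32}z_1+g_{33}z_2}{g_{11}+g_{12}z_1+g_{13}z_2}\right).$$ Fundamental domain: a set $\mathcal F\subset D^2$ is a fundamental domain for $\Gamma$ if (i) for every $z\in D^2$ there is $G\in\Gamma$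 with $G(z)\in\mathcal F$; and (ii) whenever $z\in\mathcal F$ and $G(z)\in\mathcal F$ for some $G\in\Gamma\setminus\{I\}$, then $z$ lies on the (topological) boundary of $\mathcal F$. *)

theory Defs
  imports "HOL-Analysis.Analysis"
begin

definition D2 :: "(complex \<times> complex) set" where
  "D2 = {(z1, z2). Im z2 > (1/2) * (cmod z1)\<^sup>2}"

definition conj_transpose :: "complex ^ 'n ^ 'm \<Rightarrow> complex ^ 'm ^ 'n" where
  "conj_transpose A = map_matrix cnj (transpose A)"

definition formC :: "complex ^ 3 ^ 3" where
  "formC = vector [vector [0, 0, \<i>],
                   vector [0, 1, 0],
                   vector [-\<i>, 0, 0]]"

definition gaussian_ints :: "complex set" where
  "gaussian_ints = {of_int a + of_int b * \<i> | a b. True}"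

definition Picard_group :: "(complex ^ 3 ^ 3) set" where
  "Picard_group = {A. det A = 1 \<and> conj_transpose A ** formC ** A = formC \<and>
                      (\<forall>j k. A $ j $ k \<in> gaussian_ints)}"

(* For G in Picard_group the denominator has no zero on D2: z lies in D2 iff v = (1, z1, z2)
   satisfies v^* C v < 0; G preserves this form, and vectors with first entry 0 have
   nonnegative form value.  So division by zero never matters where the action is used. *)
definition act :: "complex ^ 3 ^ 3 \<Rightarrow> complex \<times> complex \<Rightarrow> complex \<times> complex" where
  "act G = (\<lambda>(z1, z2).
     ((G $ 2 $ 1 + G $ 2 $ 2 * z1 + G $ 2 $ 3 * z2) / (G $ 1 $ 1 + G $ 1 $ 2 * z1 + G $ 1 $ 3 * z2),
      (G $ 3 $ 1 + G $ 3 $ 2 * z1 + G $ 3 $ 3 * z2) / (G $ 1 $ 1 + G $ 1 $ 2 * z1 + G $ 1 $ 3 * z2)))"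

(* D2 is open, so for points of F the frontier in the whole space and the frontier
   relative to D2 agree. *)
definition fundamental_domain ::
    "(complex ^ 3 ^ 3) set \<Rightarrow> (complex \<times> complex) set \<Rightarrow> bool" where
  "fundamental_domain \<Gamma> F \<longleftrightarrow>
     F \<subseteq> D2 \<and>
     (\<forall>z\<in>D2. \<exists>G\<in>\<Gamma>. act G z \<in> F) \<and>
     (\<forall>z\<in>F. \<forall>G\<in>\<Gamma> - {mat 1}. act G z \<in> F \<longrightarrow> z \<in> frontier F)"

end

theory Submission
  imports Defs
begin

text \<open>The height \<open>h z = Im z2 - |z1|\<^sup>2 / 2\<close> satisfies \<open>h (G z) = h z / |f|\<^sup>2\<close>, where \<open>f = g11 + g12 z1 + g13 z2\<close> is
  the denominator of \<open>G\<close>. Every orbit has a point of maximal height, which the stabilizer of the cusp moves over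
  the triangle with vertices \<open>0, 1, \<i>\<close> with \<open>|Re z2| \<le> 1/2\<close>; the remaining inequalities of the domain say
  \<open>|f| \<ge> 1\<close> for eight particular group elements, so they hold there. Conversely, these eight inequalities force
  \<open>h \<ge> 1/2\<close>. Since \<open>|f| \<ge> h |g13|\<close>, this yields \<open>|f| \<ge> 1\<close> whenever \<open>|g13| \<ge> 2\<close>, and the rows with
  \<open>|g13|\<^sup>2\<close> equal to 1 or 2 reduce to the eight given ones. If \<open>z\<close> and \<open>G z\<close> both lie in the domain, then
  \<open>|f| \<ge> 1\<close> for \<open>G\<close> at \<open>z\<close> and for the inverse of \<open>G\<close> at \<open>G z\<close>, so \<open>|f| = 1\<close>; at an interior point this makes
  \<open>f\<close> constant, so \<open>G\<close> fixes the cusp, and the triangle leaves only \<open>G = I\<close>.\<close>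

section \<open>Estimates in real coordinates\<close>

text \<open>If the bound fails, \<open>A\<close> and |t| <= 1/2 push z1 close to the vertex 1, say
  at distance of order \<open>e\<close>. There \<open>B1\<close> and \<open>B2\<close> confine
  \<open>t\<close> to at most 1.62 e, so 4 t^2 <= 2 e, while \<open>A\<close> demands that 4 t^2
  exceed 4.89 e.\<close>

lemma height_bound_right:
  fixes x y t u :: real
  assumes y: "0 \<le> y" "y \<le> x" "x + y \<le> 1" and t: "\<bar>t\<bar> \<le> 1/2" and u: "0 < u"
    and A: "t\<^sup>2 + u\<^sup>2 \<ge> 1"
    and B1: "(1 + 2*y + 2*t)\<^sup>2 + (1 - 2*x + 2*u)\<^sup>2 \<ge> 2"
    and B2: "(-1 + 2*y + 2*t)\<^sup>2 + (1 - 2*x + 2*u)\<^sup>2 \<ge> 2"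
  shows "1 + x\<^sup>2 + y\<^sup>2 \<le> 2*u"
proof (rule ccontr)
  assume neg: "\<not> 1 + x\<^sup>2 + y\<^sup>2 \<le> 2*u"
  define q where "q = x\<^sup>2 + y\<^sup>2"
  \<comment> \<open>Here \<open>q\<close> is |z1|^2 and \<open>d\<close> is |z1 - 1|^2. With
    \<open>s\<close>, the real parts in \<open>B1\<close> and \<open>B2\<close> become 1 + 2 s and
    -1 + 2 s.\<close>
  define e where "e = 1 - x"
  define d where "d = e\<^sup>2 + y\<^sup>2"
  define s where "s = t + y"
  have uq: "2*u < 1 + q" using neg by (simp add: q_def)
  have "(2*u)\<^sup>2 < (1 + q)\<^sup>2" using uq u by (intro power_strict_mono) auto
  then have tq: "4*t\<^sup>2 > 4 - (1+q)\<^sup>2" using A by (simp add: power2_eq_square)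
  have "t\<^sup>2 \<le> (1/2)\<^sup>2" using t abs_le_square_iff[of t "1/2"] by simp
  then have t2: "4*t\<^sup>2 \<le> 1" by (simp add: power2_eq_square)
  have q0: "q \<ge> 0" by (simp add: q_def)
  \<comment> \<open>Since 4 t^2 <= 1, \<open>tq\<close> gives (1+q)^2 > 3; 0.73 lies just below sqrt
    3 - 1.\<close>
  have q: "q > 0.73"
  proof (rule ccontr)
    assume "\<not> q > 0.73"
    then have "(1+q)\<^sup>2 \<le> 1.73\<^sup>2" using q0 by (intro power_mono) auto
    then show False using tq t2 by (simp add: power2_eq_square)
  qed
  have e0: "0 \<le> e" "y \<le> e" using y by (auto simp: e_def)
  have "y\<^sup>2 \<le> e\<^sup>2" using e0 y by (intro power_mono) auto
  then have d: "d \<le> 2*e\<^sup>2" and qe: "1 - q \<ge> 2 * (e * (1-e))"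
    by (auto simp: d_def q_def e_def power2_eq_square algebra_simps)
  show False
  proof (cases "x \<ge> 1/2")
    case False
    then have "x\<^sup>2 \<le> (1/2)\<^sup>2" "y\<^sup>2 \<le> (1/2)\<^sup>2" using y by (auto intro!: power_mono)
    then show False using q by (simp add: q_def power2_eq_square)
  next
    case True
    \<comment> \<open>Two rounds of bootstrapping on 2 e (1-e) <= 1 - q < 0.27: each bound on
      \<open>e\<close> improves the lower bound for the factor 1 - e.\<close>
    then have "e \<le> 1/2" by (simp add: e_def)
    then have "e * (1/2) \<le> e * (1-e)" using e0 by (intro mult_left_mono) auto
    then have "e \<le> 0.27" using qe q by simp
    then have "e * 0.73 \<le> e * (1-e)" using e0 by (intro mult_left_mono) auto
    then have e: "e \<le> 0.185" using qe q by simp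
    then have e3: "e * (163/200) \<le> e * (1-e)" using e0 by (intro mult_left_mono) auto
    have e2: "e * e \<le> 0.185 * e" using e e0 by (intro mult_right_mono) auto
    have d1: "d \<le> 0.37 * e" using d e2 by (simp add: power2_eq_square)
    have d0: "d \<ge> 0" by (simp add: d_def)
    have "d * d \<le> 0.07 * d" using d0 d1 e by (intro mult_right_mono) auto
    then have d2: "2*d + d\<^sup>2 \<le> 2.07*d" by (simp add: power2_eq_square)
    \<comment> \<open>Only the sign of 1 - 2x + 2u is wanted, so that its upper bound 1 + d may be
      squared.\<close>
    have "u > 0.85"
    proof (rule ccontr)
      assume "\<not> u > 0.85"
      then have "u\<^sup>2 \<le> 0.85\<^sup>2" using u by (intro power_mono) auto
      then show False using A t2 by (simp add: power2_eq_square)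
    qed
    then have v: "0 \<le> 1 - 2*x + 2*u" using e0 by (simp add: e_def)
    have "1 - 2*x + 2*u \<le> 1 + d"
      using uq by (simp add: d_def e_def q_def power2_eq_square algebra_simps)
    then have "(1 - 2*x + 2*u)\<^sup>2 \<le> (1 + d)\<^sup>2" using v by (intro power_mono) auto
    then have "4 * \<bar>s\<bar> - 4 * s\<^sup>2 \<le> 2*d + d\<^sup>2" using B1 B2
      by (auto simp: s_def power2_eq_square algebra_simps abs_if)
    \<comment> \<open>The constant is 1 - (1/2 + 0.185), from the bounds on |t| and on y <= e. It
      keeps |s| away from 1, where 4|s| - 4 s^2 would also be small.\<close>
    moreover have "\<bar>s\<bar> * 0.315 \<le> \<bar>s\<bar> * (1 - \<bar>s\<bar>)"
      using t y(1) e e0(2) by (intro mult_left_mono) (auto simp: s_def abs_if split: if_splits)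
    then have "4 * \<bar>s\<bar> - 4 * s\<^sup>2 \<ge> 1.26 * \<bar>s\<bar>" by (auto simp: algebra_simps power2_eq_square)
    ultimately have "\<bar>s\<bar> \<le> 0.62 * e" using d1 d2 e0 by simp
    then have "\<bar>t\<bar> \<le> 1.62 * e" using e0 y by (auto simp: s_def abs_if split: if_splits)
    then have "t\<^sup>2 \<le> (1.62 * e)\<^sup>2" using e0 abs_le_square_iff[of t "1.62 * e"] by simp
    then have "4 * t\<^sup>2 \<le> 2 * e" using e2 e0 by (simp add: power2_eq_square)
    moreover have "(1 - q) * 3 \<le> (1 - q) * (3 + q)"
      using q0 qe e3 e0 by (intro mult_left_mono) auto
    then have "4 - (1+q)\<^sup>2 \<ge> 3 * (1 - q)" by (simp add: power2_eq_square algebra_simps)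
    moreover have "1 - q \<ge> 163/100 * e"
      using order_trans[OF mult_left_mono[OF e3, of 2] qe] by simp
    ultimately show False using tq e0 by argo
  qed
qed

text \<open>The reflection exchanging \<open>x\<close> and \<open>y\<close> and negating
  \<open>t\<close> interchanges the families \<open>B\<close> and \<open>C\<close>, so it suffices
  to treat y <= x. The conclusion is height at least 1/2.\<close>

lemma height_bound:
  fixes x y t u :: real
  assumes xy: "0 \<le> x" "0 \<le> y" "x + y \<le> 1" and t: "\<bar>t\<bar> \<le> 1/2" and u: "0 < u"
    and A: "t\<^sup>2 + u\<^sup>2 \<ge> 1"
    and B: "\<And>r. r \<in> {-1, 1} \<Longrightarrow> (r + 2*y + 2*t)\<^sup>2 + (1 - 2*x + 2*u)\<^sup>2 \<ge> 2"
    and C: "\<And>r. r \<in> {-1, 1} \<Longrightarrow> (r - 2*x + 2*t)\<^sup>2 + (1 - 2*y + 2*u)\<^sup>2 \<ge> 2"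
  shows "1 + x\<^sup>2 + y\<^sup>2 \<le> 2*u"
proof (cases "y \<le> x")
  case True
  then show ?thesis using height_bound_right[of y x t u] assms B[of 1] B[of "-1"] by auto
next
  case False
  have "(1 + 2*x + 2*(-t))\<^sup>2 = (-1 - 2*x + 2*t)\<^sup>2" "(-1 + 2*x + 2*(-t))\<^sup>2 = (1 - 2*x + 2*t)\<^sup>2"
    by (auto simp: power2_eq_square algebra_simps)
  then have "1 + y\<^sup>2 + x\<^sup>2 \<le> 2*u"
    using False xy t u A C[of 1] C[of "-1"]
    by (intro height_bound_right[of x y "-t" u]) auto
  then show ?thesis by simp
qed

section \<open>Rows whose last entry has squared modulus 1 or 2\<close>

lemma square_dist_int:
  fixes x :: real and a :: int
  assumes "0 \<le> x" "x \<le> 1" "a \<notin> {0, 1}"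
  shows "(x - of_int a)\<^sup>2 \<ge> 1"
proof -
  have "a \<le> -1 \<or> a \<ge> 2" using assms(3) by auto
  then have "of_int a \<le> (-1::real) \<or> of_int a \<ge> (2::real)" by linarith
  then have "\<bar>x - of_int a\<bar> \<ge> \<bar>1\<bar>" using assms(1,2) by auto
  then show ?thesis by (metis abs_le_square_iff power_one)
qed

lemma square_le_square_plus:
  fixes a b c :: real
  assumes "\<bar>a\<bar> \<le> \<bar>b\<bar>" "k \<le> a\<^sup>2 + c" shows "k \<le> b\<^sup>2 + c"
  using assms abs_le_square_iff[of a b] by linarith

text \<open>If a row \<open>(p, q, n)\<close> with \<open>n \<noteq> 0\<close> is multiplied by \<open>cnj n\<close>, it becomes
  \<open>(P, Q, N)\<close> with \<open>N = |n|\<^sup>2\<close>; the two bounds below are the cases \<open>N = 1\<close> and \<open>N = 2\<close> (where \<open>Q\<close> is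
  necessarily even and is written \<open>2 * Q\<close>), with \<open>z1 = x + y \<i>\<close> and \<open>z2 = t + u \<i>\<close>. In both cases the
  imaginary part is controlled by the distance of \<open>z1\<close> to the Gaussian integer \<open>a = - Q2 - Q1 \<i>\<close>, so only
  the \<open>a\<close> near the triangle with vertices \<open>0, 1, \<i>\<close> matter.\<close>

lemma norm_one_row_bound:
  fixes x y t u :: real and P1 P2 Q1 Q2 :: int
  assumes xy: "0 \<le> x" "0 \<le> y" "x + y \<le> 1" and t: "\<bar>t\<bar> \<le> 1/2"
    and A: "t\<^sup>2 + u\<^sup>2 \<ge> 1"
    and h: "1 + x\<^sup>2 + y\<^sup>2 \<le> 2*u"
    and D: "\<And>r. r \<in> {-1, 0, 1} \<Longrightarrow> (r - x + y + t)\<^sup>2 + (1 - x - y + u)\<^sup>2 \<ge> 1"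
    and null: "Q1\<^sup>2 + Q2\<^sup>2 = 2 * P2"
  shows "(P1 + Q1 * x - Q2 * y + t)\<^sup>2 + (P2 + Q1 * y + Q2 * x + u)\<^sup>2 \<ge> 1"
proof -
  define im where im_def: "im = P2 + Q1 * y + Q2 * x + u"
  define kx ky where k: "kx = (x - of_int (-Q2))\<^sup>2" "ky = (y - of_int (-Q1))\<^sup>2"
  have k0: "kx \<ge> 0" "ky \<ge> 0" by (simp_all add: k)
  have "even (Q1\<^sup>2 + Q2\<^sup>2)" using null by simp
  \<comment> \<open>Parity excludes a = 1 and a = \<i>, so only a = 0 and a = 1 + \<i> remain near
    the triangle.\<close>
  then have par: "even (Q1 + Q2)" by simp
  have "(of_int Q1)\<^sup>2 + (of_int Q2)\<^sup>2 = (2 * of_int P2 :: real)"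
    using arg_cong[OF null, of real_of_int] by simp
  \<comment> \<open>Substituting \<open>null\<close> completes the square: 2 im = (2u - |z1|^2) +
    |z1 - a|^2.\<close>
  then have im: "2 * im \<ge> 1 + kx + ky"
    using h by (simp add: k im_def power2_eq_square algebra_simps)
  consider "-Q2 \<notin> {0,1} \<or> -Q1 \<notin> {0,1}" | "Q1 = 0" "Q2 = 0" | "Q1 = -1" "Q2 = -1"
    using par by force
  then show ?thesis
  proof cases
    case 1
    then have "kx \<ge> 1 \<or> ky \<ge> 1"
      using square_dist_int[of x "-Q2"] square_dist_int[of y "-Q1"] xy unfolding k by linarith
    then have "im \<ge> 1"
      by (rule disjE) (use im k0 in linarith)+
    then have "im\<^sup>2 \<ge> 1" by (simp add: one_le_power)
    then show ?thesis unfolding im_def by (smt (verit) zero_le_power2)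
  next
    case 2
    then have "P2 = 0" using null by simp
    have "P1 = 0 \<or> P1 \<le> -1 \<or> P1 \<ge> 1" by auto
    then have "\<bar>t\<bar> \<le> \<bar>P1 + t\<bar>" using t by fastforce
    from square_le_square_plus[OF this A] show ?thesis using 2 \<open>P2 = 0\<close> by simp
  next
    case 3
    then have P2: "P2 = 1" using null by simp
    have *: "1 \<le> (P1 - x + y + t)\<^sup>2 + (1 - x - y + u)\<^sup>2"
    proof -
      \<comment> \<open>As -x + y + t lies between -3/2 and 3/2, a shift by |P1| >= 2 leaves a real
        part no smaller in modulus than the shift by 1 of the same sign.\<close>
      consider "P1 \<in> {-1,0,1}" | "P1 \<le> -2" | "P1 \<ge> 2" by force
      then show ?thesis
      proof cases
        case 1
        then show ?thesis using D[of "of_int P1"] by auto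
      next
        case 2
        then have "\<bar>-1 - x + y + t\<bar> \<le> \<bar>P1 - x + y + t\<bar>" using xy t by linarith
        from square_le_square_plus[OF this D] show ?thesis by simp
      next
        case 3
        then have "\<bar>1 - x + y + t\<bar> \<le> \<bar>P1 - x + y + t\<bar>" using xy t by linarith
        from square_le_square_plus[OF this D] show ?thesis by simp
      qed
    qed
    then show ?thesis using 3 P2 by (simp add: algebra_simps)
  qed
qed

lemma norm_two_row_bound:
  fixes x y t u :: real and P1 P2 Q1 Q2 :: int
  assumes xy: "0 \<le> x" "0 \<le> y" "x + y \<le> 1" and t: "\<bar>t\<bar> \<le> 1/2"
    and A: "t\<^sup>2 + u\<^sup>2 \<ge> 1"
    and h: "1 + x\<^sup>2 + y\<^sup>2 \<le> 2*u"
    and B: "\<And>r. r \<in> {-1, 1} \<Longrightarrow> (r + 2*y + 2*t)\<^sup>2 + (1 - 2*x + 2*u)\<^sup>2 \<ge> 2"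
    and C: "\<And>r. r \<in> {-1, 1} \<Longrightarrow> (r - 2*x + 2*t)\<^sup>2 + (1 - 2*y + 2*u)\<^sup>2 \<ge> 2"
    and null: "Q1\<^sup>2 + Q2\<^sup>2 = P2" and par: "even (P1 + P2)"
  shows "(P1 + 2 * Q1 * x - 2 * Q2 * y + 2 * t)\<^sup>2 + (P2 + 2 * Q1 * y + 2 * Q2 * x + 2 * u)\<^sup>2 \<ge> 2"
proof -
  define im where im_def: "im = P2 + 2 * Q1 * y + 2 * Q2 * x + 2 * u"
  define kx ky where k: "kx = (x - of_int (-Q2))\<^sup>2" "ky = (y - of_int (-Q1))\<^sup>2"
  have k0: "kx \<ge> 0" "ky \<ge> 0" by (simp_all add: k)
  have "(of_int Q1)\<^sup>2 + (of_int Q2)\<^sup>2 = (of_int P2 :: real)"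
    using arg_cong[OF null, of real_of_int] by simp
  then have im: "im \<ge> 1 + (kx + ky)"
    using h by (simp add: k im_def power2_eq_square algebra_simps)
  \<comment> \<open>Squared distance 1/2 from \<open>a\<close> already gives im >= 3/2, and 9/4
    exceeds 2.\<close>
  have far: ?thesis if "(kx + ky) \<ge> 1/2"
  proof -
    have "im \<ge> 3/2" using that im by linarith
    then have "im\<^sup>2 \<ge> (3/2)\<^sup>2" by (intro power_mono) auto
    then have "im\<^sup>2 \<ge> 2" by (simp add: power2_eq_square)
    then show ?thesis unfolding im_def by (smt (verit) zero_le_power2)
  qed
  have half: "\<And>a b::real. a \<ge> 1/2 \<Longrightarrow> b \<ge> 1/2 \<Longrightarrow> a\<^sup>2 + b\<^sup>2 \<ge> 1/2"
  proof -
    fix a b :: real assume "a \<ge> 1/2" "b \<ge> 1/2"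
    then have "a\<^sup>2 \<ge> (1/2)\<^sup>2" "b\<^sup>2 \<ge> (1/2)\<^sup>2" by (auto intro!: power_mono)
    then show "a\<^sup>2 + b\<^sup>2 \<ge> 1/2" by (simp add: power2_eq_square)
  qed
  consider "-Q2 \<notin> {0,1} \<or> -Q1 \<notin> {0,1}" | "Q1 = 0" "Q2 = 0" | "Q1 = -1" "Q2 = -1"
    | "Q1 = 0" "Q2 = -1" | "Q1 = -1" "Q2 = 0"
    by force
  then show ?thesis
  proof cases
    case 1
    then have "kx \<ge> 1 \<or> ky \<ge> 1"
      using square_dist_int[of x "-Q2"] square_dist_int[of y "-Q1"] xy unfolding k by linarith
    then have "kx + ky \<ge> 1/2"
      by (rule disjE) (use k0 in linarith)+
    then show ?thesis by (rule far)
  next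
    case 2
    then have P2: "P2 = 0" using null by simp
    then have "even P1" using par by simp
    then have "P1 = 0 \<or> P1 \<le> -2 \<or> P1 \<ge> 2" by presburger
    then have "\<bar>2*t\<bar> \<le> \<bar>P1 + 2*t\<bar>" using t by fastforce
    moreover have "2 \<le> (2*t)\<^sup>2 + (2*u)\<^sup>2" using A by (simp add: power2_eq_square)
    ultimately show ?thesis using 2 P2 square_le_square_plus[of "2*t" "P1 + 2*t" 2 "(2*u)\<^sup>2"] by simp
  next
    case 3
    have "(x - 1)\<^sup>2 + (y - 1)\<^sup>2 \<ge> 1/2"
    proof -
      have "(x-1)\<^sup>2 + (y-1)\<^sup>2 = ((2-x-y)\<^sup>2 + (x-y)\<^sup>2)/2" by (simp add: power2_eq_square algebra_simps)
      moreover have "(2-x-y)\<^sup>2 \<ge> 1" using xy by (simp add: one_le_power)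
      ultimately show ?thesis by (smt (verit) zero_le_power2 divide_right_mono)
    qed
    then show ?thesis using far 3 k by simp
  next
    case 4
    then have P2: "P2 = 1" using null by simp
    then have "odd P1" using par by simp
    show ?thesis
    \<comment> \<open>For y >= 1/2 also 1 - x >= 1/2, so z1 is far from a = 1. Otherwise 2y + 2t <
      2, which is what lets P1 <= -3 reduce to -1.\<close>
    proof (cases "y \<ge> 1/2")
      case True
      then show ?thesis using half[of "1-x" y] xy far 4 k by (simp add: power2_commute)
    next
      case False
      consider "P1 \<in> {-1,1}" | "P1 \<le> -3" | "P1 \<ge> 3" using \<open>odd P1\<close>
        by (smt (verit) evenE oddE insert_iff)
      then have "2 \<le> (P1 + 2*y + 2*t)\<^sup>2 + (1 - 2*x + 2*u)\<^sup>2"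
      proof cases
        case 1
        then show ?thesis using B[of "of_int P1"] by auto
      next
        case 2
        then have "\<bar>-1 + 2*y + 2*t\<bar> \<le> \<bar>P1 + 2*y + 2*t\<bar>" using xy t False by linarith
        from square_le_square_plus[OF this B] show ?thesis by simp
      next
        case 3
        then have "\<bar>1 + 2*y + 2*t\<bar> \<le> \<bar>P1 + 2*y + 2*t\<bar>" using xy t by linarith
        from square_le_square_plus[OF this B] show ?thesis by simp
      qed
      then show ?thesis using 4 P2 by (simp add: algebra_simps)
    qed
  next
    case 5
    then have P2: "P2 = 1" using null by simp
    then have "odd P1" using par by simp
    show ?thesis
    proof (cases "x \<ge> 1/2")
      case True
      then show ?thesis using half[of x "1-y"] xy far 5 k by (simp add: power2_commute)
    next
      case False
      consider "P1 \<in> {-1,1}" | "P1 \<le> -3" | "P1 \<ge> 3" using \<open>odd P1\<close>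
        by (smt (verit) evenE oddE insert_iff)
      then have "2 \<le> (P1 - 2*x + 2*t)\<^sup>2 + (1 - 2*y + 2*u)\<^sup>2"
      proof cases
        case 1
        then show ?thesis using C[of "of_int P1"] by auto
      next
        case 2
        then have "\<bar>-1 - 2*x + 2*t\<bar> \<le> \<bar>P1 - 2*x + 2*t\<bar>" using xy t by linarith
        from square_le_square_plus[OF this C] show ?thesis by simp
      next
        case 3
        then have "\<bar>1 - 2*x + 2*t\<bar> \<le> \<bar>P1 - 2*x + 2*t\<bar>" using xy t False by linarith
        from square_le_square_plus[OF this C] show ?thesis by simp
      qed
      then show ?thesis using 5 P2 by (simp add: algebra_simps)
    qed
  qed
qed

section \<open>The action of the Picard modular group\<close>

definition homogeneous_vec :: "complex \<times> complex \<Rightarrow> complex^3" where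
  "homogeneous_vec z = vector [1, fst z, snd z]"

definition denom :: "complex^3^3 \<Rightarrow> complex \<times> complex \<Rightarrow> complex" where
  "denom G z = G$1$1 + G$1$2 * fst z + G$1$3 * snd z"

lemma denom_eq: "denom G z = (G *v homogeneous_vec z) $ 1"
  by (simp add: denom_def homogeneous_vec_def matrix_vector_mult_def sum_3)

lemma act_eq: "act G z = ((G *v homogeneous_vec z) $ 2 / denom G z, (G *v homogeneous_vec z) $ 3 / denom G z)"
  by (cases z) (simp add: act_def denom_def homogeneous_vec_def matrix_vector_mult_def sum_3)

text \<open>The denominator is the scalar that renormalizes homogeneous coordinates. The cocycle
  rule for \<open>denom\<close> and the composition rule for \<open>act\<close> rest on
  this.\<close>

lemma homogeneous_vec_act:
  assumes "denom G z \<noteq> 0"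
  shows "G *v homogeneous_vec z = denom G z *s homogeneous_vec (act G z)"
  using assms by (simp add: vec_eq_iff forall_3 act_eq homogeneous_vec_def denom_eq)

lemma mult_homogeneous_vec:
  assumes "denom H z \<noteq> 0"
  shows "(G ** H) *v homogeneous_vec z = denom H z *s (G *v homogeneous_vec (act H z))"
  by (simp only: matrix_vector_mul_assoc[symmetric] homogeneous_vec_act[OF assms] vector_scalar_commute)

lemma denom_mult:
  assumes "denom H z \<noteq> 0"
  shows "denom (G ** H) z = denom G (act H z) * denom H z"
  by (simp only: denom_eq[of "G ** H"] denom_eq[of G] mult_homogeneous_vec[OF assms]) simp

lemma act_mult:
  assumes "denom H z \<noteq> 0"
  shows "act (G ** H) z = act G (act H z)"
  using assms by (simp add: act_eq[of "G ** H"] act_eq[of G] denom_mult mult_homogeneous_vec del: matrix_vector_mul_assoc)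

section \<open>Group structure and integrality\<close>

lemma gaussian_ints_iff: "z \<in> gaussian_ints \<longleftrightarrow> Re z \<in> \<int> \<and> Im z \<in> \<int>"
  by (auto simp: gaussian_ints_def Ints_def complex_eq_iff)

lemma gaussian_ints_add: "a \<in> gaussian_ints \<Longrightarrow> b \<in> gaussian_ints \<Longrightarrow> a + b \<in> gaussian_ints"
  and gaussian_ints_mult: "a \<in> gaussian_ints \<Longrightarrow> b \<in> gaussian_ints \<Longrightarrow> a * b \<in> gaussian_ints"
  and gaussian_ints_cnj: "a \<in> gaussian_ints \<Longrightarrow> cnj a \<in> gaussian_ints"
  by (simp_all add: gaussian_ints_iff)

lemma gaussian_matrix_mult:
  fixes A B :: "complex^3^3"
  assumes "\<And>j k. A $ j $ k \<in> gaussian_ints" "\<And>j k. B $ j $ k \<in> gaussian_ints"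
  shows "(A ** B) $ j $ k \<in> gaussian_ints"
  by (simp add: matrix_matrix_mult_def sum_3 assms gaussian_ints_add gaussian_ints_mult)

lemma conj_transpose_nth [simp]: "conj_transpose A $ j $ k = cnj (A $ k $ j)"
  by (simp add: conj_transpose_def map_matrix_def transpose_def)

lemma conj_transpose_mult:
  "conj_transpose ((A :: complex^3^3) ** B) = conj_transpose B ** conj_transpose A"
  by (simp add: vec_eq_iff matrix_matrix_mult_def sum_3 mult.commute)

lemma conj_transpose_involutive [simp]: "conj_transpose (conj_transpose A) = A"
  by (simp add: vec_eq_iff)

lemma formC_nth [simp]:
  "formC $ 1 $ 1 = 0" "formC $ 1 $ 2 = 0" "formC $ 1 $ 3 = \<i>"
  "formC $ 2 $ 1 = 0" "formC $ 2 $ 2 = 1" "formC $ 2 $ 3 = 0"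
  "formC $ 3 $ 1 = -\<i>" "formC $ 3 $ 2 = 0" "formC $ 3 $ 3 = 0"
  by (simp_all add: formC_def)

lemma formC_squared: "formC ** formC = mat 1"
  by (simp add: vec_eq_iff forall_3 matrix_matrix_mult_def sum_3 mat_def)

lemma conj_transpose_formC [simp]: "conj_transpose formC = formC"
  by (simp add: vec_eq_iff forall_3)

lemma gaussian_formC: "formC $ j $ k \<in> gaussian_ints"
  using exhaust_3[of j] exhaust_3[of k] by (auto simp: gaussian_ints_iff)

lemma Picard_groupD:
  assumes "A \<in> Picard_group"
  shows "det A = 1" "conj_transpose A ** formC ** A = formC" "A $ j $ k \<in> gaussian_ints"
  using assms by (auto simp: Picard_group_def)

lemma Picard_group_mult:
  assumes "A \<in> Picard_group" "B \<in> Picard_group"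
  shows "A ** B \<in> Picard_group"
proof -
  have "conj_transpose (A ** B) ** formC ** (A ** B)
      = conj_transpose B ** (conj_transpose A ** formC ** A) ** B"
    by (simp add: conj_transpose_mult matrix_mul_assoc)
  then show ?thesis
    using assms by (auto simp: Picard_group_def det_mul gaussian_matrix_mult)
qed

lemma Picard_group_one: "mat 1 \<in> Picard_group"
proof -
  have "conj_transpose (mat 1) = (mat 1 :: complex^3^3)"
    by (simp add: vec_eq_iff mat_def)
  moreover have "mat 1 $ j $ k \<in> gaussian_ints" for j k :: 3
    by (simp add: mat_def gaussian_ints_iff)
  ultimately show ?thesis by (simp add: Picard_group_def)
qed

text \<open>Because \<open>formC\<close> squares to the identity, multiplying the defining relation
  by \<open>formC\<close> on the left displays the inverse, which visibly has Gaussian integer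
  entries.\<close>

lemma Picard_group_inverse:
  assumes "A \<in> Picard_group"
  defines "B \<equiv> formC ** conj_transpose A ** formC"
  shows "B \<in> Picard_group" "B ** A = mat 1" "A ** B = mat 1"
proof -
  note A = Picard_groupD[OF assms(1)]
  have "B ** A = formC ** (conj_transpose A ** formC ** A)"
    by (simp add: B_def matrix_mul_assoc)
  then show BA: "B ** A = mat 1" by (simp add: A formC_squared)
  then show AB: "A ** B = mat 1" by (simp add: matrix_left_right_inverse)
  have "det B * det A = det (mat 1 :: complex^3^3)" using BA det_mul[of B A] by simp
  then have d: "det B = 1" by (simp add: A)
  have "conj_transpose B = formC ** A ** formC"
    by (simp add: B_def conj_transpose_mult matrix_mul_assoc)
  then have "conj_transpose B ** formC ** B = formC ** A ** (formC ** formC) ** B"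
    by (simp add: matrix_mul_assoc)
  also have "\<dots> = formC"
    by (simp add: formC_squared matrix_mul_assoc[symmetric] AB)
  finally show "B \<in> Picard_group"
    using d A(3) by (auto simp: Picard_group_def B_def gaussian_matrix_mult gaussian_formC gaussian_ints_cnj)
qed

text \<open>The defining relation concerns columns; this transfers it to rows, because the
  denominator sees only the first row.\<close>

lemma Picard_group_rows:
  assumes "A \<in> Picard_group"
  shows "A ** formC ** conj_transpose A = formC"
proof -
  have "A ** (formC ** conj_transpose A ** formC) ** formC = formC"
    using Picard_group_inverse(3)[OF assms] by simp
  then show ?thesis
    by (simp add: matrix_mul_assoc[symmetric] formC_squared)
qed

text \<open>The first row is isotropic, as the upper left entry of \<open>formC\<close> is
  0.\<close>

lemma Picard_group_first_row:
  assumes "A \<in> Picard_group"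
  shows "(cmod (A$1$2))\<^sup>2 = 2 * Im (A$1$1 * cnj (A$1$3))"
proof -
  have "(A ** formC ** conj_transpose A) $ 1 $ 1 = 0"
    using Picard_group_rows[OF assms] by simp
  then show ?thesis
    by (simp add: matrix_matrix_mult_def sum_3 complex_eq_iff cmod_power2)
       (simp add: power2_eq_square algebra_simps)
qed

section \<open>Height, denominators and invariance of D2\<close>

definition height :: "complex \<times> complex \<Rightarrow> real" where
  "height z = Im (snd z) - (cmod (fst z))\<^sup>2 / 2"

lemma D2_iff: "z \<in> D2 \<longleftrightarrow> 0 < height z"
  by (cases z) (simp add: D2_def height_def)

text \<open>Everything metric about a row follows from this completed square: it bounds \<open>denom A z\<close> from below, and
  leaves only finitely many rows with \<open>|denom A z| \<le> 1\<close>.\<close>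

lemma denom_identity:
  assumes "A \<in> Picard_group"
  shows "(cmod (A$1$2 + \<i> * A$1$3 * cnj (fst z)))\<^sup>2 + 2 * height z * (cmod (A$1$3))\<^sup>2
    = 2 * Im (denom A z * cnj (A$1$3))"
  using Picard_group_first_row[OF assms]
  unfolding cmod_power2 height_def denom_def
  by (simp add: field_simps power2_eq_square)

lemma denom_lower_bound:
  assumes "A \<in> Picard_group"
  shows "height z * cmod (A$1$3) \<le> cmod (denom A z)"
proof (cases "A$1$3 = 0")
  case False
  have "2 * height z * (cmod (A$1$3))\<^sup>2 \<le> 2 * Im (denom A z * cnj (A$1$3))"
    using denom_identity[OF assms, of z] zero_le_power2 by (smt (verit))
  also have "\<dots> \<le> 2 * (cmod (denom A z) * cmod (A$1$3))"
    using abs_Im_le_cmod[of "denom A z * cnj (A$1$3)"] by (simp add: norm_mult)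
  finally show ?thesis using False by (simp add: power2_eq_square)
qed simp

text \<open>A vanishing last entry means that the cusp at infinity is fixed: isotropy then kills the
  middle entry, and the determinant forbids a zero row.\<close>

lemma first_row_degenerate:
  assumes "A \<in> Picard_group" "A$1$3 = 0"
  shows "A$1$2 = 0" "A$1$1 \<noteq> 0" "denom A z = A$1$1"
proof -
  show *: "A$1$2 = 0" using Picard_group_first_row[OF assms(1)] assms(2) by simp
  show "A$1$1 \<noteq> 0" using Picard_groupD(1)[OF assms(1)] assms(2) * by (auto simp: det_3)
  show "denom A z = A$1$1" by (simp add: denom_def * assms)
qed

lemma denom_nonzero:
  assumes "A \<in> Picard_group" "z \<in> D2"
  shows "denom A z \<noteq> 0"
proof (cases "A$1$3 = 0")
  case True
  then show ?thesis using first_row_degenerate[OF assms(1)] by metis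
next
  case False
  then have "0 < height z * cmod (A$1$3)" using assms(2) by (simp add: D2_iff)
  then show ?thesis using denom_lower_bound[OF assms(1), of z] by auto
qed

text \<open>Both sides are the Hermitian form of \<open>formC\<close>, at \<open>A *v v\<close> and
  at \<open>v\<close>; moving \<open>A\<close> to the other argument as its adjoint produces the
  defining relation.\<close>

lemma hermitian_form_invariant:
  assumes "A \<in> Picard_group"
  shows "(cmod ((A *v v) $ 2))\<^sup>2 - 2 * Im (cnj ((A *v v) $ 1) * (A *v v) $ 3)
    = (cmod (v $ 2))\<^sup>2 - 2 * Im (cnj (v $ 1) * v $ 3)"
proof -
  have form: "(\<Sum>j\<in>UNIV. cnj (w $ j) * (formC *v w) $ j)
      = of_real ((cmod (w $ 2))\<^sup>2 - 2 * Im (cnj (w $ 1) * w $ 3))" for w :: "complex^3"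
    by (simp add: sum_3 matrix_vector_mult_def complex_eq_iff cmod_power2)
       (simp add: power2_eq_square algebra_simps)
  have adj: "(\<Sum>j\<in>UNIV. cnj ((A *v v) $ j) * w $ j)
      = (\<Sum>j\<in>UNIV. cnj (v $ j) * (conj_transpose A *v w) $ j)" for w :: "complex^3"
    by (simp add: sum_3 matrix_vector_mult_def algebra_simps)
  have "(\<Sum>j\<in>UNIV. cnj ((A *v v) $ j) * (formC *v (A *v v)) $ j)
      = (\<Sum>j\<in>UNIV. cnj (v $ j) * (formC *v v) $ j)"
    by (subst adj) (simp add: matrix_vector_mul_assoc matrix_mul_assoc Picard_groupD(2)[OF assms])
  then show ?thesis by (simp only: form of_real_eq_iff)
qed

text \<open>The invariant form takes the value -2 \<open>height z\<close> at
  \<open>homogeneous_vec z\<close>, and rescaling by the denominator multiplies it by the squared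
  modulus.\<close>

lemma height_act:
  assumes "A \<in> Picard_group" "z \<in> D2"
  shows "height (act A z) * (cmod (denom A z))\<^sup>2 = height z"
proof -
  note nz = denom_nonzero[OF assms]
  define d where "d = denom A z"
  define w where "w = act A z"
  have "(cmod ((A *v homogeneous_vec z) $ 2))\<^sup>2 - 2 * Im (cnj ((A *v homogeneous_vec z) $ 1) * (A *v homogeneous_vec z) $ 3)
      = -2 * height z"
    by (subst hermitian_form_invariant[OF assms(1)]) (simp add: homogeneous_vec_def height_def)
  then have "(cmod (d * fst w))\<^sup>2 - 2 * Im (cnj d * (d * snd w)) = -2 * height z"
    unfolding homogeneous_vec_act[OF nz] by (simp add: homogeneous_vec_def d_def w_def del: complex_mult_cnj)
  moreover have "Im (cnj d * (d * snd w)) = (cmod d)\<^sup>2 * Im (snd w)"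
    by (simp add: cmod_power2) (simp add: power2_eq_square algebra_simps)
  ultimately show ?thesis
    by (simp add: height_def norm_mult power_mult_distrib field_simps flip: d_def w_def)
qed

lemma act_D2:
  assumes "A \<in> Picard_group" "z \<in> D2"
  shows "act A z \<in> D2"
  using height_act[OF assms] assms(2) denom_nonzero[OF assms]
  by (metis D2_iff mult_nonpos_nonneg not_less zero_le_power2)

section \<open>The Ford inequalities\<close>

text \<open>The conditions governed by the stabilizer of the cusp alone; they do not restrict the
  height.\<close>

definition cusp_prism :: "(complex \<times> complex) set" where
  "cusp_prism = {z. 0 \<le> Re (fst z) \<and> 0 \<le> Im (fst z) \<and> Re (fst z) + Im (fst z) \<le> 1 \<and> \<bar>Re (snd z)\<bar> \<le> 1/2}"

definition picard_domain :: "(complex \<times> complex) set" where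
  "picard_domain = {(z1, z2). (z1, z2) \<in> D2 \<and>
       0 \<le> Re z1 \<and> 0 \<le> Im z1 \<and> Re z1 + Im z1 \<le> 1 \<and> \<bar>Re z2\<bar> \<le> 1/2 \<and>
       (cmod z2)\<^sup>2 \<ge> 1 \<and>
       (\<forall>r\<in>{-1, 0, 1}. (cmod (r + \<i> - (1 + \<i>) * z1 + z2))\<^sup>2 \<ge> 1) \<and>
       (\<forall>r\<in>{-1, 1}. (cmod (r + \<i> - 2 * \<i> * z1 + 2 * z2))\<^sup>2 \<ge> 2) \<and>
       (\<forall>r\<in>{-1, 1}. (cmod (r + \<i> - 2 * z1 + 2 * z2))\<^sup>2 \<ge> 2)}"

text \<open>Restates the domain in the form of the real estimates. Only the last claim, height at
  least 1/2, is not read off the definition.\<close>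

lemma picard_domain_coords:
  assumes "z \<in> picard_domain"
  defines "x \<equiv> Re (fst z)" and "y \<equiv> Im (fst z)" and "t \<equiv> Re (snd z)" and "u \<equiv> Im (snd z)"
  shows "0 \<le> x" "0 \<le> y" "x + y \<le> 1" "\<bar>t\<bar> \<le> 1/2" "t\<^sup>2 + u\<^sup>2 \<ge> 1"
    and "\<And>r. r \<in> {-1, 0, 1} \<Longrightarrow> (r - x + y + t)\<^sup>2 + (1 - x - y + u)\<^sup>2 \<ge> 1"
    and "\<And>r. r \<in> {-1, 1} \<Longrightarrow> (r + 2*y + 2*t)\<^sup>2 + (1 - 2*x + 2*u)\<^sup>2 \<ge> 2"
    and "\<And>r. r \<in> {-1, 1} \<Longrightarrow> (r - 2*x + 2*t)\<^sup>2 + (1 - 2*y + 2*u)\<^sup>2 \<ge> 2"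
    and "1 + x\<^sup>2 + y\<^sup>2 \<le> 2 * u"
proof -
  obtain z1 z2 where z: "z = (z1, z2)" by (cases z)
  note F = assms(1)[unfolded z picard_domain_def, simplified]
  show 1: "0 \<le> x" "0 \<le> y" "x + y \<le> 1" "\<bar>t\<bar> \<le> 1/2" "t\<^sup>2 + u\<^sup>2 \<ge> 1"
    using F by (auto simp: x_def y_def t_def u_def z cmod_power2)
  show "(r - x + y + t)\<^sup>2 + (1 - x - y + u)\<^sup>2 \<ge> 1" if "r \<in> {-1, 0, 1}" for r
    using F that by (auto simp: x_def y_def t_def u_def z cmod_power2 algebra_simps)
  show 2: "(r + 2*y + 2*t)\<^sup>2 + (1 - 2*x + 2*u)\<^sup>2 \<ge> 2" if "r \<in> {-1, 1}" for r
    using F that by (auto simp: x_def y_def t_def u_def z cmod_power2 algebra_simps)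
  show 3: "(r - 2*x + 2*t)\<^sup>2 + (1 - 2*y + 2*u)\<^sup>2 \<ge> 2" if "r \<in> {-1, 1}" for r
    using F that by (auto simp: x_def y_def t_def u_def z cmod_power2 algebra_simps)
  have "(cmod z1)\<^sup>2 / 2 < u" using F by (simp add: D2_def u_def z)
  then have "0 < u" by (smt (verit) zero_le_power2 divide_nonneg_nonneg)
  then show "1 + x\<^sup>2 + y\<^sup>2 \<le> 2 * u" by (intro height_bound[OF 1(1-4) _ 1(5) 2 3])
qed

lemma gaussian_intE:
  assumes "z \<in> gaussian_ints"
  obtains a b :: int where "z = of_int a + of_int b * \<i>"
  using assms by (auto simp: gaussian_ints_def)

text \<open>The parity input below: a sum of two squares is never 3, equals 2 only for odd terms,
  and is divisible by 4 only for even terms.\<close>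

lemma square_mod_4: "(a::int)\<^sup>2 mod 4 = a mod 2"
proof (cases "even a")
  case True
  then obtain b where "a = 2 * b" by (rule evenE)
  then show ?thesis by (simp add: power_mult_distrib)
next
  case False
  then obtain b where b: "a = 2 * b + 1" by (rule oddE)
  have "a\<^sup>2 = 1 + 4 * (b\<^sup>2 + b)" by (simp add: b power2_eq_square algebra_simps)
  then have "a\<^sup>2 mod 4 = 1" by presburger
  then show ?thesis using False by presburger
qed

text \<open>Split on N = |g13|^2. For 0 the denominator is a nonzero Gaussian integer, 1 and 2 are
  the row bounds, 3 is not a sum of two squares, and from 4 on height at least 1/2 suffices.\<close>

lemma denom_ge_one:
  assumes G: "G \<in> Picard_group" and z: "z \<in> picard_domain"
  shows "1 \<le> cmod (denom G z)"
proof -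
  define x y t u where xy: "x = Re (fst z)" "y = Im (fst z)" "t = Re (snd z)" "u = Im (snd z)"
  note F = picard_domain_coords[OF z, folded xy]
  obtain p1 p2 where p: "G$1$1 = of_int p1 + of_int p2 * \<i>"
    using Picard_groupD(3)[OF G, of 1 1] by (elim gaussian_intE)
  obtain q1 q2 where q: "G$1$2 = of_int q1 + of_int q2 * \<i>"
    using Picard_groupD(3)[OF G, of 1 2] by (elim gaussian_intE)
  obtain n1 n2 where n: "G$1$3 = of_int n1 + of_int n2 * \<i>"
    using Picard_groupD(3)[OF G, of 1 3] by (elim gaussian_intE)
  define N P1 P2 Q1 Q2 where N: "N = n1\<^sup>2 + n2\<^sup>2"
    and P: "P1 = p1 * n1 + p2 * n2" "P2 = p2 * n1 - p1 * n2"
    and Q: "Q1 = q1 * n1 + q2 * n2" "Q2 = q2 * n1 - q1 * n2"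
  have cN: "(cmod (G$1$3))\<^sup>2 = of_int N" by (simp add: n N cmod_power2)
  have "real_of_int (q1\<^sup>2 + q2\<^sup>2) = of_int (2 * P2)"
    using Picard_group_first_row[OF G] by (simp add: p q n P cmod_power2)
  then have qP: "q1\<^sup>2 + q2\<^sup>2 = 2 * P2" by (simp only: of_int_eq_iff)
  have "Q1\<^sup>2 + Q2\<^sup>2 = (q1\<^sup>2 + q2\<^sup>2) * N"
    by (simp add: Q N power2_eq_square algebra_simps)
  then have QP: "Q1\<^sup>2 + Q2\<^sup>2 = 2 * P2 * N" by (simp add: qP)
  have f: "(cmod (denom G z))\<^sup>2 * of_int N
     = (P1 + Q1 * x - Q2 * y + N * t)\<^sup>2 + (P2 + Q1 * y + Q2 * x + N * u)\<^sup>2"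
  proof -
    have "(cmod (denom G z))\<^sup>2 * of_int N = (cmod (denom G z * cnj (G$1$3)))\<^sup>2"
      by (simp add: norm_mult power_mult_distrib cN)
    also have "denom G z * cnj (G$1$3) =
      Complex (P1 + Q1 * x - Q2 * y + N * t) (P2 + Q1 * y + Q2 * x + N * u)"
      by (simp add: denom_def p q n P Q N xy complex_eq_iff) (simp add: power2_eq_square algebra_simps)
    finally show ?thesis by (simp add: cmod_power2)
  qed
  have sq: "1 \<le> cmod (denom G z)" if "1 \<le> (cmod (denom G z))\<^sup>2"
    using that power2_le_imp_le[of 1 "cmod (denom G z)"] by simp
  have "N \<ge> 0" by (simp add: N)
  moreover have "N \<noteq> 3"
    using square_mod_4[of n1] square_mod_4[of n2] unfolding N by presburger
  ultimately consider "N = 0" | "N = 1" | "N = 2" | "N \<ge> 4" by linarith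
  then show ?thesis
  proof cases
    case 1
    then have "G$1$3 = 0" using cN by simp
    note d = first_row_degenerate[OF G this]
    have "p1\<^sup>2 + p2\<^sup>2 \<noteq> 0" using d(2) p by auto
    then have "1 \<le> p1\<^sup>2 + p2\<^sup>2" by (smt (verit) zero_le_power2)
    then have "1 \<le> real_of_int (p1\<^sup>2 + p2\<^sup>2)" by linarith
    then show ?thesis by (intro sq) (simp add: d(3) p cmod_power2)
  next
    case 2
    have "1 \<le> (P1 + Q1 * x - Q2 * y + t)\<^sup>2 + (P2 + Q1 * y + Q2 * x + u)\<^sup>2"
      using norm_one_row_bound[OF F(1-5,9,6), of Q1 Q2 P2 P1] QP 2 by simp
    then show ?thesis using f 2 sq by simp
  next
    case 3
    have "Q1\<^sup>2 + Q2\<^sup>2 = 4 * P2" using QP 3 by simp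
    then have "even Q1" "even Q2"
      using square_mod_4[of Q1] square_mod_4[of Q2] by presburger+
    then obtain b1 b2 where b: "Q1 = 2 * b1" "Q2 = 2 * b2" by (auto elim!: evenE)
    have "odd n1" "odd n2"
      using square_mod_4[of n1] square_mod_4[of n2] 3 unfolding N by presburger+
    \<comment> \<open>With \<open>n1\<close> and \<open>n2\<close> odd, both \<open>P1\<close> and
      \<open>P2\<close> are congruent to p1 + p2 modulo 2.\<close>
    then have "even (P1 + P2)" by (auto simp: P)
    moreover have "b1\<^sup>2 + b2\<^sup>2 = P2" using QP 3 b by (simp add: power_mult_distrib)
    ultimately have "2 \<le> (P1 + 2 * b1 * x - 2 * b2 * y + 2 * t)\<^sup>2 + (P2 + 2 * b1 * y + 2 * b2 * x + 2 * u)\<^sup>2"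
      using norm_two_row_bound[OF F(1-5,9,7,8), of b1 b2 P2 P1] by simp
    then show ?thesis using f 3 b sq by simp
  next
    case 4
    have "1/2 \<le> height z" using F(9) by (simp add: height_def cmod_power2 xy field_simps)
    moreover have "2 \<le> cmod (G$1$3)" using 4 cN by (intro power2_le_imp_le[of 2]) auto
    ultimately have "(1/2) * 2 \<le> height z * cmod (G$1$3)" by (intro mult_mono) auto
    then show ?thesis using denom_lower_bound[OF G, of z] by simp
  qed
qed

section \<open>Reduction into the domain\<close>

lemma finite_gaussian_ball: "finite {w \<in> gaussian_ints. cmod w \<le> B}"
proof -
  define k where "k = \<lceil>B\<rceil>"
  have "{w \<in> gaussian_ints. cmod w \<le> B}
      \<subseteq> (\<lambda>(a, b). of_int a + of_int b * \<i>) ` ({-k..k} \<times> {-k..k})"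
  proof
    fix w assume "w \<in> {w \<in> gaussian_ints. cmod w \<le> B}"
    then obtain a b :: int where w: "w = of_int a + of_int b * \<i>" "cmod w \<le> B"
      by (auto simp: gaussian_ints_def)
    then have "\<bar>real_of_int a\<bar> \<le> B" "\<bar>real_of_int b\<bar> \<le> B"
      using abs_Re_le_cmod[of w] abs_Im_le_cmod[of w] by auto
    then have "\<bar>a\<bar> \<le> k" "\<bar>b\<bar> \<le> k" unfolding k_def by linarith+
    then show "w \<in> (\<lambda>(a, b). of_int a + of_int b * \<i>) ` ({-k..k} \<times> {-k..k})"
      unfolding w(1) by (intro image_eqI[where x = "(a, b)"]) auto
  qed
  then show ?thesis by (rule finite_subset) auto
qed

text \<open>A smallest denominator means maximal height in the orbit. It exists because only
  finitely many first rows give modulus at most 1, and the identity is one such element.\<close>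

lemma minimal_denom:
  assumes "z \<in> D2"
  obtains G where "G \<in> Picard_group" "\<And>H. H \<in> Picard_group \<Longrightarrow> cmod (denom G z) \<le> cmod (denom H z)"
proof -
  define \<Gamma>\<^sub>1 where "\<Gamma>\<^sub>1 = {G \<in> Picard_group. cmod (denom G z) \<le> 1}"
  \<comment> \<open>These bound the first row from right to left: \<open>B3\<close> by the lower
    bound on the denominator, \<open>B2\<close> by the completed square, \<open>B1\<close> by
    solving the denominator for its constant term.\<close>
  define B3 where "B3 = 1 / height z"
  define B2 where "B2 = sqrt (2 * B3) + B3 * cmod (fst z)"
  define B1 where "B1 = 1 + B2 * cmod (fst z) + B3 * cmod (snd z)"
  define ball where "ball = (\<lambda>B. {w \<in> gaussian_ints. cmod w \<le> B})"
  have h: "0 < height z" using assms by (simp add: D2_iff)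
  have bounds: "cmod (G$1$3) \<le> B3" "cmod (G$1$2) \<le> B2" "cmod (G$1$1) \<le> B1" if "G \<in> \<Gamma>\<^sub>1" for G
  proof -
    have G: "G \<in> Picard_group" and f: "cmod (denom G z) \<le> 1" using that by (auto simp: \<Gamma>\<^sub>1_def)
    have "height z * cmod (G$1$3) \<le> 1" using denom_lower_bound[OF G, of z] f by simp
    then show 3: "cmod (G$1$3) \<le> B3" using h by (simp add: B3_def field_simps)
    have "(cmod (G$1$2 + \<i> * G$1$3 * cnj (fst z)))\<^sup>2 \<le> 2 * Im (denom G z * cnj (G$1$3))"
      using denom_identity[OF G, of z] h mult_nonneg_nonneg[of "2 * height z" "(cmod (G$1$3))\<^sup>2"]
      by (smt (verit) zero_le_power2)
    also have "\<dots> \<le> 2 * (cmod (denom G z) * cmod (G$1$3))"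
      using abs_Im_le_cmod[of "denom G z * cnj (G$1$3)"] by (simp add: norm_mult)
    also have "\<dots> \<le> 2 * (1 * B3)" using f 3 by (intro mult_left_mono mult_mono) auto
    finally have "cmod (G$1$2 + \<i> * G$1$3 * cnj (fst z)) \<le> sqrt (2 * B3)"
      by (simp add: real_le_rsqrt)
    moreover have "cmod (\<i> * G$1$3 * cnj (fst z)) \<le> B3 * cmod (fst z)"
      using 3 by (simp add: norm_mult mult_right_mono)
    moreover have "cmod (G$1$2) \<le> cmod (G$1$2 + \<i> * G$1$3 * cnj (fst z)) + cmod (\<i> * G$1$3 * cnj (fst z))"
      using norm_triangle_ineq4[of "G$1$2 + \<i> * G$1$3 * cnj (fst z)" "\<i> * G$1$3 * cnj (fst z)"] by simp
    ultimately show 2: "cmod (G$1$2) \<le> B2" by (simp add: B2_def)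
    have "G$1$1 = denom G z - G$1$2 * fst z - G$1$3 * snd z" by (simp add: denom_def)
    then have "cmod (G$1$1) \<le> cmod (denom G z) + cmod (G$1$2 * fst z) + cmod (G$1$3 * snd z)"
      using norm_triangle_ineq4[of "denom G z - G$1$2 * fst z" "G$1$3 * snd z"]
        norm_triangle_ineq4[of "denom G z" "G$1$2 * fst z"] by simp
    also have "\<dots> \<le> B1"
      using f 2 3 unfolding B1_def norm_mult by (intro add_mono mult_right_mono) auto
    finally show "cmod (G$1$1) \<le> B1" .
  qed
  \<comment> \<open>The set \<open>\<Gamma>\<^sub>1\<close> itself is infinite, as it contains every
    translation; finiteness holds for the values, which depend on the first row only.\<close>
  have "(\<lambda>G. cmod (denom G z)) ` \<Gamma>\<^sub>1
      \<subseteq> (\<lambda>(a, b, c). cmod (a + b * fst z + c * snd z)) ` (ball B1 \<times> ball B2 \<times> ball B3)"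
  proof
    fix v assume "v \<in> (\<lambda>G. cmod (denom G z)) ` \<Gamma>\<^sub>1"
    then obtain G where G: "G \<in> \<Gamma>\<^sub>1" "v = cmod (denom G z)" by auto
    then have "(G$1$1, G$1$2, G$1$3) \<in> ball B1 \<times> ball B2 \<times> ball B3"
      using bounds[OF G(1)] by (auto simp: ball_def \<Gamma>\<^sub>1_def Picard_groupD(3))
    then show "v \<in> (\<lambda>(a, b, c). cmod (a + b * fst z + c * snd z)) ` (ball B1 \<times> ball B2 \<times> ball B3)"
      by (rule rev_image_eqI) (simp add: G denom_def)
  qed
  then have fin: "finite ((\<lambda>G. cmod (denom G z)) ` \<Gamma>\<^sub>1)"
    by (rule finite_subset) (auto simp: ball_def finite_gaussian_ball)
  have "denom (mat 1) z = 1" by (simp add: denom_def mat_def)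
  then have "mat 1 \<in> \<Gamma>\<^sub>1" by (simp add: \<Gamma>\<^sub>1_def Picard_group_one)
  then have ne: "(\<lambda>G. cmod (denom G z)) ` \<Gamma>\<^sub>1 \<noteq> {}" by blast
  obtain G where G: "G \<in> \<Gamma>\<^sub>1" "Min ((\<lambda>G. cmod (denom G z)) ` \<Gamma>\<^sub>1) = cmod (denom G z)"
    using Min_in[OF fin ne] by auto
  show thesis
  proof
    show "G \<in> Picard_group" using G(1) by (simp add: \<Gamma>\<^sub>1_def)
    fix H assume H: "H \<in> Picard_group"
    show "cmod (denom G z) \<le> cmod (denom H z)"
    proof (cases "H \<in> \<Gamma>\<^sub>1")
      case True
      then show ?thesis using Min_le[OF fin] G(2) by auto
    next
      case False
      then show ?thesis using G(1) H by (auto simp: \<Gamma>\<^sub>1_def)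
    qed
  qed
qed

text \<open>The inversion (z1, z2) -> (z1/z2, -1/z2), with denominator z2; it moves the cusp at
  infinity.\<close>

definition swap_matrix :: "complex^3^3" where
  "swap_matrix = vector [vector [0, 0, 1], vector [0, 1, 0], vector [-1, 0, 0]]"

text \<open>For a unit \<open>c\<close> of the Gaussian integers the middle entry makes the
  determinant c^4 = 1; the action is z1 -> c z1.\<close>

definition rotation :: "complex \<Rightarrow> complex^3^3" where
  "rotation c = vector [vector [c, 0, 0], vector [0, c\<^sup>2, 0], vector [0, 0, c]]"

text \<open>The Heisenberg translation by \<open>(1 + \<i>) * (m + n \<i>)\<close>; its lower left entry is an integral point because
  this number has norm \<open>2 * (m\<^sup>2 + n\<^sup>2)\<close>.\<close>

definition translation :: "int \<Rightarrow> int \<Rightarrow> int \<Rightarrow> complex^3^3" where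
  "translation m n r = vector [
     vector [1, 0, 0],
     vector [of_int (m - n) + of_int (m + n) * \<i>, 1, 0],
     vector [of_int r + of_int (m\<^sup>2 + n\<^sup>2) * \<i>, of_int (m + n) + of_int (m - n) * \<i>, 1]]"

lemma Picard_groupI:
  assumes "det A = 1" "conj_transpose A ** formC ** A = formC"
    "\<forall>j k. Re (A $ j $ k) \<in> \<int> \<and> Im (A $ j $ k) \<in> \<int>"
  shows "A \<in> Picard_group"
  using assms by (auto simp: Picard_group_def gaussian_ints_iff)

lemma swap_matrix_Picard: "swap_matrix \<in> Picard_group"
  by (rule Picard_groupI)
     (simp_all add: swap_matrix_def det_3 vec_eq_iff forall_3 matrix_matrix_mult_def sum_3)

lemma rotation_Picard: "c \<in> {1, \<i>, -1, -\<i>} \<Longrightarrow> rotation c \<in> Picard_group"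
  by (rule Picard_groupI)
     (auto simp: rotation_def det_3 vec_eq_iff forall_3 matrix_matrix_mult_def sum_3 power2_eq_square)

lemma translation_Picard: "translation m n r \<in> Picard_group"
  by (rule Picard_groupI)
     (simp_all add: translation_def det_3 vec_eq_iff forall_3 matrix_matrix_mult_def sum_3,
      simp_all add: complex_eq_iff power2_eq_square algebra_simps)

lemma act_rotation:
  assumes "c \<noteq> 0"
  shows "denom (rotation c) z = c" "act (rotation c) z = (c * fst z, snd z)"
  using assms by (cases z; simp add: denom_def act_def rotation_def power2_eq_square)+

lemma act_translation:
  "denom (translation m n r) z = 1"
  "act (translation m n r) z =
    (fst z + (of_int (m - n) + of_int (m + n) * \<i>),
     snd z + (of_int (m + n) + of_int (m - n) * \<i>) * fst z + of_int r + of_int (m\<^sup>2 + n\<^sup>2) * \<i>)"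
  by (cases z; simp add: denom_def act_def translation_def algebra_simps)+

text \<open>These two families of first rows supply all the Ford inequalities of the domain.\<close>

lemma denom_swap_translation:
  "denom (swap_matrix ** translation m n r) z =
     of_int r + of_int (m\<^sup>2 + n\<^sup>2) * \<i> + (of_int (m + n) + of_int (m - n) * \<i>) * fst z + snd z"
  "denom (swap_matrix ** translation m n r ** swap_matrix) z =
     -1 + (of_int (m + n) + of_int (m - n) * \<i>) * fst z + (of_int r + of_int (m\<^sup>2 + n\<^sup>2) * \<i>) * snd z"
  by (simp_all add: denom_def swap_matrix_def translation_def matrix_matrix_mult_def sum_3)

text \<open>A lattice translation brings z1 into the square with vertices 1, \<i>, -1, -\<i>, a
  quarter turn into the triangle, and a vertical translation adjusts Re z2. None of them changes the
  modulus of a denominator.\<close>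

lemma reduce_to_prism:
  obtains P where "P \<in> Picard_group" "\<And>w. cmod (denom P w) = 1" "act P z \<in> cusp_prism"
proof -
  \<comment> \<open>In the coordinates (Re + Im)/2 and (Im - Re)/2 the lattice of multiples of 1 +
    \<i> becomes the integer lattice.\<close>
  define m n where "m = - round ((Re (fst z) + Im (fst z)) / 2)" "n = - round ((Im (fst z) - Re (fst z)) / 2)"
  define a where "a = act (translation m n 0) z"
  have "\<bar>(Re (fst z) + Im (fst z)) / 2 + m\<bar> \<le> 1/2" "\<bar>(Im (fst z) - Re (fst z)) / 2 + n\<bar> \<le> 1/2"
    using of_int_round_abs_le[of "(Re (fst z) + Im (fst z)) / 2"]
      of_int_round_abs_le[of "(Im (fst z) - Re (fst z)) / 2"]
    unfolding m_n_def of_int_minus by linarith+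
  then have sum: "\<bar>Re (fst a) + Im (fst a)\<bar> \<le> 1" "\<bar>Im (fst a) - Re (fst a)\<bar> \<le> 1"
    by (auto simp: a_def act_translation abs_if field_simps split: if_splits)
  obtain c :: complex where c: "c \<in> {1, \<i>, -1, -\<i>}" "0 \<le> Re (c * fst a)" "0 \<le> Im (c * fst a)"
    "Re (c * fst a) + Im (c * fst a) \<le> 1"
  proof -
    consider "Re (fst a) \<ge> 0" "Im (fst a) \<ge> 0" | "Re (fst a) \<ge> 0" "Im (fst a) \<le> 0"
      | "Re (fst a) \<le> 0" "Im (fst a) \<ge> 0" | "Re (fst a) \<le> 0" "Im (fst a) \<le> 0" by linarith
    then show ?thesis
      using that[of 1] that[of \<i>] that[of "-1"] that[of "-\<i>"] sum by cases auto
  qed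
  define b where "b = act (rotation c) a"
  define r where "r = - round (Re (snd b))"
  have c1: "cmod c = 1" using c(1) by auto
  then have c0: "c \<noteq> 0" by auto
  define P where "P = translation 0 0 r ** (rotation c ** translation m n 0)"
  have den: "cmod (denom P w) = 1" for w
    using c0 c1 unfolding P_def by (simp add: denom_mult act_rotation act_translation)
  have "act P z = act (translation 0 0 r) b"
    using c0 unfolding P_def b_def a_def by (simp add: act_mult denom_mult act_rotation(1) act_translation(1))
  then have "act P z \<in> cusp_prism"
    using c(2-4) c0 abs_minus_commute[of "Re (snd b)" "of_int (round (Re (snd b)))"]
      of_int_round_abs_le[of "Re (snd b)"]
    by (simp add: cusp_prism_def act_translation b_def act_rotation r_def)
  moreover have "P \<in> Picard_group"
    unfolding P_def using c(1) by (intro Picard_group_mult translation_Picard rotation_Picard)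
  ultimately show thesis using den that by blast
qed

text \<open>Each Ford inequality is \<open>min\<close> for one explicit element. In
  \<open>N2\<close> the factor c = 2/(r + \<i>), of squared modulus 2, normalizes the coefficient of
  z2 to 2.\<close>

lemma picard_domainI:
  assumes z: "z \<in> D2" "z \<in> cusp_prism"
    and min: "\<And>H. H \<in> Picard_group \<Longrightarrow> 1 \<le> cmod (denom H z)"
  shows "z \<in> picard_domain"
proof -
  obtain z1 z2 where zz: "z = (z1, z2)" by (cases z)
  have sq: "1 \<le> (cmod w)\<^sup>2" if "1 \<le> cmod w" for w using that by (simp add: one_le_power)
  have N1: "1 \<le> (cmod (of_int r + of_int (m\<^sup>2 + n\<^sup>2) * \<i> + (of_int (m + n) + of_int (m - n) * \<i>) * z1 + z2))\<^sup>2"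
    for m n r
    using sq[OF min[OF Picard_group_mult[OF swap_matrix_Picard translation_Picard[of m n r]]]]
    unfolding denom_swap_translation zz by simp
  have N2: "2 \<le> (cmod w)\<^sup>2"
    if "w = c * (-1 + (of_int (m + n) + of_int (m - n) * \<i>) * z1 + (of_int r + of_int (m\<^sup>2 + n\<^sup>2) * \<i>) * z2)"
      "(cmod c)\<^sup>2 = 2"
    for m n r c w
    using sq[OF min[OF Picard_group_mult[OF Picard_group_mult[OF swap_matrix_Picard
        translation_Picard[of m n r]] swap_matrix_Picard]]]
    unfolding denom_swap_translation zz that(1) norm_mult power_mult_distrib that(2) by simp
  \<comment> \<open>The forms of norm 2 are a unit multiple of \<open>1 + \<i>\<close> times the denominator of a group element.\<close>
  have c: "(cmod (-1 - \<i>))\<^sup>2 = 2" "(cmod (1 - \<i>))\<^sup>2 = 2" by (simp_all add: cmod_power2)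
  have "2 \<le> (cmod (1 + \<i> - 2 * \<i> * z1 + 2 * z2))\<^sup>2"
    by (rule N2[of _ "-1 - \<i>" 1 0 "-1"]) (simp_all add: c algebra_simps)
  moreover have "2 \<le> (cmod (-1 + \<i> - 2 * \<i> * z1 + 2 * z2))\<^sup>2"
    by (rule N2[of _ "1 - \<i>" 0 1 1]) (simp_all add: c algebra_simps)
  moreover have "2 \<le> (cmod (1 + \<i> - 2 * z1 + 2 * z2))\<^sup>2"
    by (rule N2[of _ "-1 - \<i>" 0 1 "-1"]) (simp_all add: c algebra_simps)
  moreover have "2 \<le> (cmod (-1 + \<i> - 2 * z1 + 2 * z2))\<^sup>2"
    by (rule N2[of _ "1 - \<i>" "-1" 0 1]) (simp_all add: c algebra_simps)
  moreover have "1 \<le> (cmod (of_int r + \<i> - (1 + \<i>) * z1 + z2))\<^sup>2" for r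
    using N1[of r "-1" 0] by (simp add: algebra_simps)
  from this[of "-1"] this[of 0] this[of 1]
  have "\<forall>r\<in>{-1, 0, 1}. (cmod (r + \<i> - (1 + \<i>) * z1 + z2))\<^sup>2 \<ge> 1" by simp
  moreover have "1 \<le> (cmod z2)\<^sup>2" using N1[of 0 0 0] by simp
  ultimately show ?thesis
    using z by (simp add: picard_domain_def cusp_prism_def zz)
qed

text \<open>Moving a point of maximal height into the prism keeps the denominator minimal; by the
  cocycle rule, minimality at \<open>z\<close> says that every denominator at the new point has
  modulus at least 1.\<close>

lemma orbit_meets_picard_domain:
  assumes z: "z \<in> D2"
  obtains G where "G \<in> Picard_group" "act G z \<in> picard_domain"
proof -
  obtain G where G: "G \<in> Picard_group" "\<And>H. H \<in> Picard_group \<Longrightarrow> cmod (denom G z) \<le> cmod (denom H z)"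
    using minimal_denom[OF z] by blast
  obtain P where P: "P \<in> Picard_group" "\<And>w. cmod (denom P w) = 1" "act P (act G z) \<in> cusp_prism"
    using reduce_to_prism[of "act G z"] by blast
  define K where "K = P ** G"
  have K: "K \<in> Picard_group" using P(1) G(1) by (simp add: K_def Picard_group_mult)
  have Gz: "denom G z \<noteq> 0" and Kz: "denom K z \<noteq> 0" using denom_nonzero z G(1) K by auto
  have dK: "cmod (denom K z) = cmod (denom G z)"
    using P(2) by (simp add: K_def denom_mult[OF Gz] norm_mult)
  have "act K z \<in> picard_domain"
  proof (rule picard_domainI)
    show "act K z \<in> D2" using act_D2[OF K z] .
    show "act K z \<in> cusp_prism" using P(3) by (simp add: K_def act_mult[OF Gz])
    fix H assume "H \<in> Picard_group"
    then have "cmod (denom K z) \<le> cmod (denom (H ** K) z)"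
      unfolding dK by (intro G(2) Picard_group_mult K)
    then show "1 \<le> cmod (denom H (act K z))"
      using Kz by (simp add: denom_mult norm_mult)
  qed
  then show thesis using that K by blast
qed

section \<open>Interior points\<close>

lemma interior_shift:
  fixes S :: "(complex \<times> complex) set"
  assumes "z \<in> interior S"
  obtains e where "e > 0"
    "\<And>a. cmod a \<le> e \<Longrightarrow> (fst z + a, snd z) \<in> S" "\<And>a. cmod a \<le> e \<Longrightarrow> (fst z, snd z + a) \<in> S"
proof -
  obtain e where e: "e > 0" "cball z e \<subseteq> S" using assms by (auto simp: mem_interior_cball)
  have "(fst z + a, snd z) \<in> S" "(fst z, snd z + a) \<in> S" if "cmod a \<le> e" for a
    using that e(2) by (cases z; auto simp: dist_Pair_Pair dist_norm subset_iff)+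
  then show thesis using that e(1) by blast
qed

lemma interior_picard_domain:
  assumes "z \<in> interior picard_domain"
  shows "0 < Re (fst z)" "0 < Im (fst z)" "Re (fst z) + Im (fst z) < 1" "\<bar>Re (snd z)\<bar> < 1/2"
proof -
  obtain e where e: "e > 0"
    "\<And>a. cmod a \<le> e \<Longrightarrow> (fst z + a, snd z) \<in> picard_domain"
    "\<And>a. cmod a \<le> e \<Longrightarrow> (fst z, snd z + a) \<in> picard_domain"
    using interior_shift[OF assms] by blast
  note c = picard_domain_coords(1-4)
  show "0 < Re (fst z)" using c(1)[OF e(2)[of "- of_real e"]] e(1) by simp
  show "0 < Im (fst z)" using c(2)[OF e(2)[of "- of_real e * \<i>"]] e(1) by (simp add: norm_mult)
  show "Re (fst z) + Im (fst z) < 1" using c(3)[OF e(2)[of "of_real e"]] e(1) by simp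
  show "\<bar>Re (snd z)\<bar> < 1/2"
    using c(4)[OF e(3)[of "of_real e"]] c(4)[OF e(3)[of "- of_real e"]] e(1)
    by (auto simp: abs_if split: if_splits)
qed


text \<open>If the denominator really depended on z2, a small move of z2 inside the domain would
  bring its modulus below 1.\<close>

lemma interior_denom_one:
  assumes G: "G \<in> Picard_group" and z: "z \<in> interior picard_domain" and one: "cmod (denom G z) = 1"
  shows "G$1$3 = 0"
proof (rule ccontr)
  assume nz: "G$1$3 \<noteq> 0"
  obtain e where e: "e > 0" "\<And>a. cmod a \<le> e \<Longrightarrow> (fst z, snd z + a) \<in> picard_domain"
    by (rule interior_shift[OF z]) (rule that)
  \<comment> \<open>Moving the second coordinate of \<open>z\<close> slightly inside the domain scales the denominator by \<open>1 - k\<close>.\<close>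
  define k where "k = min 1 (e * cmod (G$1$3))"
  have k: "0 < k" "k \<le> 1" "k \<le> e * cmod (G$1$3)" using e(1) nz by (auto simp: k_def)
  define a where "a = - of_real k * denom G z / G$1$3"
  have "cmod a = k / cmod (G$1$3)" using k(1) one by (simp add: a_def norm_mult norm_divide)
  also have "\<dots> \<le> e" using k(3) nz by (simp add: divide_le_eq)
  finally have "1 \<le> cmod (denom G (fst z, snd z + a))" by (intro denom_ge_one[OF G] e(2))
  also have "denom G (fst z, snd z + a) = denom G z + G$1$3 * a"
    by (simp add: denom_def algebra_simps)
  also have "G$1$3 * a = - of_real k * denom G z" using nz by (simp add: a_def)
  also have "denom G z + - of_real k * denom G z = of_real (1 - k) * denom G z"
    by (simp add: algebra_simps)
  also have "cmod \<dots> = 1 - k" using k one by (simp only: norm_mult norm_of_real) simp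
  finally show False using k(1) by simp
qed

section \<open>The stabilizer of the cusp\<close>

lemma gaussian_unit:
  assumes "w \<in> gaussian_ints" "cmod w = 1"
  shows "w \<in> {1, \<i>, -1, -\<i>}"
proof -
  obtain a b where w: "w = of_int a + of_int b * \<i>" using assms(1) by (elim gaussian_intE)
  have "real_of_int (a\<^sup>2 + b\<^sup>2) = 1"
    using assms(2) cmod_power2[of w] by (simp add: w)
  then have ab: "a\<^sup>2 + b\<^sup>2 = 1" by linarith
  then have "a\<^sup>2 \<le> 1" "b\<^sup>2 \<le> 1" using zero_le_power2[of a] zero_le_power2[of b] by linarith+
  then have "\<bar>a\<bar> \<le> 1" "\<bar>b\<bar> \<le> 1" by (simp_all add: abs_square_le_1)
  then have "a \<in> {-1,0,1}" "b \<in> {-1,0,1}" by auto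
  then show ?thesis using ab by (auto simp: w)
qed

text \<open>The row relations and the determinant make such a matrix lower triangular with
  unimodular diagonal: a rotation combined with a Heisenberg translation.\<close>

lemma Picard_cusp_stabilizer:
  assumes G: "G \<in> Picard_group" and "G$1$3 = 0" and one: "cmod (G$1$1) = 1"
  shows "G$1$2 = 0" "G$2$3 = 0" "G$3$3 = G$1$1" "(G$1$1)\<^sup>2 * G$2$2 = 1"
    "cmod (G$3$2) = cmod (G$2$1)"
    "G$2$2 * cnj (G$3$2) + \<i> * G$2$1 * cnj (G$1$1) = 0"
    "(cmod (G$3$2))\<^sup>2 = 2 * Im (G$3$1 * cnj (G$1$1))"
proof -
  show 12: "G$1$2 = 0" using first_row_degenerate[OF G assms(2)] by blast
  note rows = Picard_group_rows[OF G, unfolded vec_eq_iff forall_3 matrix_matrix_mult_def sum_3, simplified]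
  have unit: "G$1$1 * cnj (G$1$1) = 1"
    by (simp add: complex_norm_square[symmetric] one del: complex_mult_cnj)
  then have nz: "G$1$1 \<noteq> 0" by auto
  show 23: "G$2$3 = 0" using rows 12 assms(2) nz by auto
  have "G$1$1 * cnj (G$3$3) = 1" using rows 12 assms(2) by auto
  then have "G$1$1 * cnj (G$3$3) = G$1$1 * cnj (G$1$1)" using unit by simp
  then show 33: "G$3$3 = G$1$1" using nz by simp
  show "(G$1$1)\<^sup>2 * G$2$2 = 1"
    using Picard_groupD(1)[OF G] by (simp add: det_3 12 23 33 assms(2) power2_eq_square algebra_simps)
  show e: "G$2$2 * cnj (G$3$2) + \<i> * G$2$1 * cnj (G$1$1) = 0"
    using rows 23 33 by (auto simp: algebra_simps)
  have "cmod (G$2$2) = 1"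
    using arg_cong[OF \<open>(G$1$1)\<^sup>2 * G$2$2 = 1\<close>, of cmod] one by (simp add: norm_mult norm_power)
  moreover have "cmod (G$2$2 * cnj (G$3$2)) = cmod (\<i> * G$2$1 * cnj (G$1$1))"
    using e by (metis add_eq_0_iff norm_minus_cancel)
  ultimately show "cmod (G$3$2) = cmod (G$2$1)" using one by (simp add: norm_mult)
  show "(cmod (G$3$2))\<^sup>2 = 2 * Im (G$3$1 * cnj (G$1$1))"
    using rows 33 by (auto simp: complex_eq_iff cmod_power2) (simp add: power2_eq_square algebra_simps)
qed

lemma prism_stabilizer_trivial:
  assumes G: "G \<in> Picard_group" "G$1$3 = 0" "cmod (G$1$1) = 1"
    and x: "0 < Re (fst z)" "0 < Im (fst z)" "Re (fst z) + Im (fst z) < 1" "\<bar>Re (snd z)\<bar> < 1/2"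
    and act: "act G z \<in> cusp_prism"
  shows "G = mat 1"
proof -
  note s = Picard_cusp_stabilizer[OF G]
  obtain b1 b2 where b: "G$2$1 = of_int b1 + of_int b2 * \<i>"
    using Picard_groupD(3)[OF G(1), of 2 1] by (elim gaussian_intE)
  obtain d1 d2 where d: "G$3$1 = of_int d1 + of_int d2 * \<i>"
    using Picard_groupD(3)[OF G(1), of 3 1] by (elim gaussian_intE)
  have unit: "G$1$1 \<in> {1, \<i>, -1, -\<i>}"
    using gaussian_unit Picard_groupD(3)[OF G(1)] G(3) by blast
  then have "Im (G$3$1 * cnj (G$1$1)) \<in> \<int>" by (auto simp: d)
  then obtain k where "Im (G$3$1 * cnj (G$1$1)) = of_int k" by (elim Ints_cases)
  then have "real_of_int (b1\<^sup>2 + b2\<^sup>2) = of_int (2 * k)"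
    using s(5,7) by (simp add: b cmod_power2)
  then have "b1\<^sup>2 + b2\<^sup>2 = 2 * k" by (simp only: of_int_eq_iff)
  \<comment> \<open>The translation part is thus a multiple of 1 + \<i>. This excludes the quarter
    turns about (1 + \<i>)/2, which would map the triangle to one overlapping it.\<close>
  then have "even (b1\<^sup>2 + b2\<^sup>2)" by simp
  then have par: "even (b1 + b2)" by simp
  define w where "w = fst (act G z)"
  have fw: "w = (G$2$1 + G$2$2 * fst z) / G$1$1" and
    sw: "snd (act G z) = (G$3$1 + G$3$2 * fst z + G$1$1 * snd z) / G$1$1"
    using s(1-3) G(2) by (cases z; simp add: w_def act_def)+
  have w: "0 \<le> Re w" "0 \<le> Im w" "Re w + Im w \<le> 1"
    using act by (auto simp: cusp_prism_def w_def)
  have 1: "G$1$1 = 1"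
  proof (rule ccontr)
    assume "G$1$1 \<noteq> 1"
    then consider "G$1$1 = -1" | "G$1$1 = \<i>" | "G$1$1 = -\<i>" using unit by auto
    then show False
    proof cases
      case 1
      then have "G$2$2 = 1" using s(4) by simp
      then have "- real_of_int b1 - Re (fst z) \<ge> 0" "- real_of_int b2 - Im (fst z) \<ge> 0"
        "- real_of_int b1 - Re (fst z) + (- real_of_int b2 - Im (fst z)) \<le> 1"
        using w by (simp_all add: fw b 1)
      moreover from this have "b1 < 0" "b2 < 0" using x(1,2) by linarith+
      ultimately show False using x(3) by linarith
    next
      case 2
      then have "G$2$2 = -1" using s(4) by (simp add: minus_equation_iff)
      then have "real_of_int b2 - Im (fst z) \<ge> 0" "Re (fst z) - real_of_int b1 \<ge> 0"
        "real_of_int b2 - Im (fst z) + (Re (fst z) - real_of_int b1) \<le> 1"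
        using w by (simp_all add: fw b 2)
      then have "b2 > 0" "b1 \<le> 0" "b2 - b1 < 2" using x by linarith+
      then show False using par by presburger
    next
      case 3
      then have "G$2$2 = -1" using s(4) by (simp add: minus_equation_iff)
      then have "Im (fst z) - real_of_int b2 \<ge> 0" "real_of_int b1 - Re (fst z) \<ge> 0"
        "Im (fst z) - real_of_int b2 + (real_of_int b1 - Re (fst z)) \<le> 1"
        using w by (simp_all add: fw b 3)
      then have "b1 > 0" "b2 \<le> 0" "b1 - b2 < 2" using x by linarith+
      then show False using par by presburger
    qed
  qed
  have 22: "G$2$2 = 1" using s(4) 1 by simp
  have "real_of_int b1 + Re (fst z) \<ge> 0" "real_of_int b2 + Im (fst z) \<ge> 0"
    "real_of_int b1 + Re (fst z) + (real_of_int b2 + Im (fst z)) \<le> 1"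
    using w by (simp_all add: fw b 1 22)
  then have "b1 \<ge> 0" "b2 \<ge> 0" "b1 + b2 < 1" using x by linarith+
  then have "b1 = 0" "b2 = 0" by linarith+
  then have 21: "G$2$1 = 0" by (simp add: b)
  then have 32: "G$3$2 = 0" using s(5) by simp
  have "d2 = 0" using s(7) by (simp add: 32 d 1)
  moreover have "\<bar>real_of_int d1 + Re (snd z)\<bar> \<le> 1/2"
    using act by (simp add: cusp_prism_def sw 32 1 d)
  then have "d1 = 0" using x(4) by linarith
  ultimately have "G$3$1 = 0" by (simp add: d)
  then show ?thesis
    using s(1-3) G(2) 1 22 21 32 by (simp add: vec_eq_iff forall_3 mat_def)
qed

lemma picard_domain_subset_prism: "picard_domain \<subseteq> D2 \<inter> cusp_prism"
  by (auto simp: picard_domain_def cusp_prism_def)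

text \<open>The denominators of \<open>G\<close> at \<open>z\<close> and of its inverse at
  \<open>act G z\<close> have product 1 and moduli at least 1, hence modulus exactly 1; so
  \<open>G\<close> fixes the cusp.\<close>

lemma interior_picard_domain_trivial:
  assumes G: "G \<in> Picard_group" and z: "z \<in> interior picard_domain" and Gz: "act G z \<in> picard_domain"
  shows "G = mat 1"
proof -
  have zF: "z \<in> picard_domain" using z interior_subset by blast
  then have nz: "denom G z \<noteq> 0" using denom_nonzero[OF G] picard_domain_subset_prism by blast
  obtain H where H: "H \<in> Picard_group" "H ** G = mat 1"
    using Picard_group_inverse(1,2)[OF G] by blast
  have "denom H (act G z) * denom G z = 1"
    using denom_mult[OF nz, of H] H(2) by (simp add: denom_def mat_def)
  then have "cmod (denom H (act G z)) * cmod (denom G z) = 1"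
    using norm_mult[of "denom H (act G z)" "denom G z"] by simp
  moreover have "1 \<le> cmod (denom H (act G z))" "1 \<le> cmod (denom G z)"
    using denom_ge_one H(1) G Gz zF by blast+
  ultimately have one: "cmod (denom G z) = 1"
    using mult_right_mono[of 1 "cmod (denom H (act G z))" "cmod (denom G z)"] by simp
  have 13: "G$1$3 = 0" by (rule interior_denom_one[OF G z one])
  have "cmod (G$1$1) = 1" using one first_row_degenerate(3)[OF G 13, of z] by simp
  then show ?thesis
    using prism_stabilizer_trivial[OF G 13 _ interior_picard_domain[OF z]] Gz picard_domain_subset_prism
    by blast
qed

lemma fundamental_domain_picard_domain: "fundamental_domain Picard_group picard_domain"
  unfolding fundamental_domain_def
proof (intro conjI ballI impI)
  show "picard_domain \<subseteq> D2" using picard_domain_subset_prism by (rule subset_trans) simp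
next
  fix z assume "z \<in> D2"
  then obtain G where "G \<in> Picard_group" "act G z \<in> picard_domain" by (rule orbit_meets_picard_domain)
  then show "\<exists>G\<in>Picard_group. act G z \<in> picard_domain" ..
next
  fix z G assume z: "z \<in> picard_domain" and G: "G \<in> Picard_group - {mat 1}" and Gz: "act G z \<in> picard_domain"
  have "z \<notin> interior picard_domain"
  proof
    assume "z \<in> interior picard_domain"
    then have "G = mat 1" using G Gz by (intro interior_picard_domain_trivial) auto
    then show False using G by simp
  qed
  then show "z \<in> frontier picard_domain"
    using subsetD[OF closure_subset z] by (simp add: frontier_def)
qed

theorem theorem1:
  shows "fundamental_domain Picard_group
    {(z1, z2). (z1, z2) \<in> D2 \<and>
       0 \<le> Re z1 \<and> 0 \<le> Im z1 \<and> Re z1 + Im z1 \<le> 1 \<and> \<bar>Re z2\<bar> \<le> 1/2 \<and>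
       (cmod z2)\<^sup>2 \<ge> 1 \<and>
       (\<forall>r\<in>{-1, 0, 1}. (cmod (r + \<i> - (1 + \<i>) * z1 + z2))\<^sup>2 \<ge> 1) \<and>
       (\<forall>r\<in>{-1, 1}. (cmod (r + \<i> - 2 * \<i> * z1 + 2 * z2))\<^sup>2 \<ge> 2) \<and>
       (\<forall>r\<in>{-1, 1}. (cmod (r + \<i> - 2 * z1 + 2 * z2))\<^sup>2 \<ge> 2)}"
  using fundamental_domain_picard_domain unfolding picard_domain_def .

end
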